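(* Let $n\ge1$, let $H_0=1$ and $H_j\in(0,1)$ for $j=1,\dots,n+1$, and let $B^1_{H_1},\dots,B^{n+1}_{H_{n+1}}$ be independent fractional Brownian motions with Hurst parameters $H_1,\dots,H_{n+1}$. For the $n$-times iterated fractional Brownian motion $$I^n_F(t)=B^1_{H_1}(|B^2_{H_2}(\ldots|B^{n+1}_{H_{n+1}}(t)|\ldots)|),\qquad t>0,$$ the even-order moments are $$E\left\{I^n_F(t)\right\}^{2k}=\frac{2^{n+1}\,t^{2k\prod_{j=1}^{n+1}H_j}}{2^{k\sum_{r=0}^{n}\prod_{j=0}^{r}H_j}}\prod_{r=0}^{n}\frac{\Gamma\left(2k\prod_{j=0}^{r}H_j\right)}{\Gamma\left(k\prod_{j=0}^{r}H_j\right)},\qquad k\in\mathbb{N} .$$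
   Context: A fractional Brownian motion $B_H$ with Hurst parameter $H\in(0,1)$ is a centred Gaussian process with covariance $E\{B_H(s)B_H(t)\}=\frac12\left(|t|^{2H}+|s|^{2H}-|t-s|^{2H}\right)$. $E\{X\}^{2k}$ denotes the moment $E[X^{2k}]$, $\Gamma$ is the Gamma function, and $\mathbb{N}=\{1,2,\dots\}$.
   Formalization: The fractional Brownian motions are taken in their version with continuous sample paths; Gaussianity and covariance alone do not determine a process at random times, and the moment formula fails for arbitrary versions. *)

theory Defs
  imports "HOL-Probability.Probability"
begin

text \<open>Constants count as (degenerate) Gaussian variables, as is needed for linear combinations
  of the values of a Gaussian process.\<close>

definition gaussian_rv :: "'a measure \<Rightarrow> ('a \<Rightarrow> real) \<Rightarrow> bool" where
  "gaussian_rv M X \<longleftrightarrow> X \<in> borel_measurable M \<and>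
     (\<exists>\<mu>. (AE \<omega> in M. X \<omega> = \<mu>) \<or>
          (\<exists>\<sigma>>0. distributed M lborel X (\<lambda>x. ennreal (normal_density \<mu> \<sigma> x))))"

definition gaussian_process :: "'a measure \<Rightarrow> real set \<Rightarrow> (real \<Rightarrow> 'a \<Rightarrow> real) \<Rightarrow> bool" where
  "gaussian_process M T X \<longleftrightarrow>
     (\<forall>F c. finite F \<and> F \<subseteq> T \<longrightarrow> gaussian_rv M (\<lambda>\<omega>. \<Sum>t\<in>F. c t * X t \<omega>))"

text \<open>The time set is \<open>[0,\<infinity>)\<close>; nothing is required of \<open>B t\<close> for negative \<open>t\<close>, so a
  fractional Brownian motion on the whole line qualifies as well. The law of the process does not
  determine its values at random times, so that composing processes is meaningful only for a
  suitable version: as usual, this is the one with continuous sample paths.\<close>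

definition fractional_brownian_motion ::
    "'a measure \<Rightarrow> real \<Rightarrow> (real \<Rightarrow> 'a \<Rightarrow> real) \<Rightarrow> bool" where
  "fractional_brownian_motion M H B \<longleftrightarrow>
     0 < H \<and> H < 1 \<and>
     gaussian_process M {0..} B \<and>
     (\<forall>t\<ge>0. (\<integral>\<omega>. B t \<omega> \<partial>M) = 0) \<and>
     (\<forall>s\<ge>0. \<forall>t\<ge>0. (\<integral>\<omega>. B s \<omega> * B t \<omega> \<partial>M) =
        (\<bar>t\<bar> powr (2 * H) + \<bar>s\<bar> powr (2 * H) - \<bar>t - s\<bar> powr (2 * H)) / 2) \<and>
     (\<forall>\<omega>\<in>space M. continuous_on {0..} (\<lambda>t. B t \<omega>))"

text \<open>Mutual independence of the processes, each viewed as a random element of the product space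
  \<open>\<real>\<^bsup>[0,\<infinity>)\<^esup>\<close>.\<close>

definition indep_processes ::
    "'a measure \<Rightarrow> nat set \<Rightarrow> (nat \<Rightarrow> real \<Rightarrow> 'a \<Rightarrow> real) \<Rightarrow> bool" where
  "indep_processes M J B \<longleftrightarrow>
     prob_space.indep_vars M (\<lambda>_. PiM {0..} (\<lambda>_. borel)) (\<lambda>j \<omega>. \<lambda>t\<in>{0..}. B j t \<omega>) J"

text \<open>\<open>B j\<close> is the process written with superscript \<open>j\<close>, so that
  \<open>iterated_process B n t = B 1 \<bar>B 2 \<bar>\<dots> \<bar>B (n + 1) t\<bar> \<dots>\<bar>\<bar>\<close>.\<close>

fun iterated_process :: "(nat \<Rightarrow> real \<Rightarrow> 'a \<Rightarrow> real) \<Rightarrow> nat \<Rightarrow> real \<Rightarrow> 'a \<Rightarrow> real" where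
  "iterated_process B 0 t \<omega> = B 1 t \<omega>"
| "iterated_process B (Suc n) t \<omega> = iterated_process B n \<bar>B (n + 2) t \<omega>\<bar> \<omega>"

end

theory Submission
  imports Defs
begin

text \<open>A centred Gaussian variable with variance \<open>v\<close> has absolute moment \<open>c p * v powr (p / 2)\<close> of
  every real order \<open>p > 0\<close>, where Legendre's duplication formula brings \<open>c p\<close> into the form
  \<open>2 * Gamma p / (2 powr (p / 2) * Gamma (p / 2))\<close>. Conditioning on the innermost motion, which
  is independent of the others, turns the moment of order \<open>p\<close> of the \<open>(n + 1)\<close>-fold iterate into a
  moment of the innermost motion of order \<open>p\<close> times the product of the outer Hurst parameters; so
  induction works once all real orders are admitted. Fubini's theorem applies because continuous
  processes are jointly measurable in time and sample point.\<close>

section \<open>Absolute moments of centred normal variables\<close>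

lemma Gamma_legendre_duplication_real:
  fixes x :: real
  assumes "x > 0"
  shows "Gamma x * Gamma (x + 1/2) = 2 powr (1 - 2 * x) * sqrt pi * Gamma (2 * x)"
proof -
  have "complex_of_real x \<notin> \<int>\<^sub>\<le>\<^sub>0" "complex_of_real x + 1/2 \<notin> \<int>\<^sub>\<le>\<^sub>0"
    using assms by (auto elim!: nonpos_Ints_cases simp: complex_eq_iff)
  from Gamma_legendre_duplication[OF this]
  have "complex_of_real (Gamma x * Gamma (x + 1/2)) =
      complex_of_real (exp ((1 - 2 * x) * ln 2) * sqrt pi * Gamma (2 * x))"
    by (simp flip: Gamma_complex_of_real exp_of_real)
  then show ?thesis
    by (simp only: of_real_eq_iff powr_def) simp
qed

text \<open>The Gaussian integral produces the left side, the theorem is phrased with the right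
  side. Duplication at \<open>p / 2\<close> trades \<open>Gamma ((p + 1) / 2)\<close> for a quotient
  of Gamma values.\<close>

lemma powr_Gamma_half_eq:
  fixes p :: real
  assumes "p > 0"
  shows "2 powr (p / 2) * Gamma ((p + 1) / 2) / sqrt pi = 2 * Gamma p / (2 powr (p / 2) * Gamma (p / 2))"
proof -
  have pos: "Gamma (p / 2) > 0"
    using assms by (simp add: Gamma_real_pos)
  have "Gamma (p / 2) * Gamma ((p + 1) / 2) = 2 powr (1 - p) * sqrt pi * Gamma p"
    using Gamma_legendre_duplication_real[of "p / 2"] assms by (simp add: add_divide_distrib)
  then have "Gamma ((p + 1) / 2) = 2 powr (1 - p) * sqrt pi * Gamma p / Gamma (p / 2)"
    using pos by (simp add: field_simps)
  moreover have "2 powr (p / 2) * 2 powr (1 - p) = 2 / 2 powr (p / 2)"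
    by (simp flip: powr_add powr_diff add: field_simps powr_mult_base)
  ultimately show ?thesis
    by (simp add: mult.assoc[symmetric])
qed

text \<open>On the positive half-line the substitution y = x^2 / (2 \<sigma>^2) leads to Euler's
  integral for \<open>Gamma ((p + 1) / 2)\<close>; evenness of the integrand then doubles the
  result.\<close>

lemma has_bochner_integral_normal_abs_powr:
  fixes \<sigma> p :: real
  assumes \<sigma>: "\<sigma> > 0" and p: "p > 0"
  shows "has_bochner_integral lborel (\<lambda>x. normal_density 0 \<sigma> x * \<bar>x\<bar> powr p)
    (2 * \<sigma> powr p * Gamma p / (2 powr (p / 2) * Gamma (p / 2)))"
proof -
  \<comment> \<open>\<open>f\<close> is Euler's integrand, \<open>g\<close> the substitution, and
    \<open>C\<close> collects the constants by which
    \<open>\<bar>x / \<sigma>\<^sup>2\<bar> * f (g x)\<close> differs from the wanted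
    integrand.\<close>
  define f where "f t = t powr ((p + 1) / 2 - 1) / exp t" for t :: real
  define g where "g x = x\<^sup>2 / (2 * \<sigma>\<^sup>2)" for x
  define C where "C = \<sigma> powr p * 2 powr (p / 2) / (2 * sqrt pi)"
  have image_g: "g ` {0<..} = {0<..}"
  proof (intro equalityI subsetI)
    fix y :: real assume y: "y \<in> {0<..}"
    then have "g (\<sigma> * sqrt (2 * y)) = y"
      using \<sigma> by (simp add: g_def power_mult_distrib)
    then show "y \<in> g ` {0<..}"
      using y \<sigma> by (intro image_eqI[of _ _ "\<sigma> * sqrt (2 * y)"]) auto
  qed (use \<sigma> in \<open>auto simp: g_def\<close>)
  have inj_g: "inj_on g {0<..}"
    using \<sigma> by (auto simp: inj_on_def g_def)
  have deriv_g: "(g has_field_derivative x / \<sigma>\<^sup>2) (at x within {0<..})" for x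
    unfolding g_def using \<sigma> by (auto intro!: derivative_eq_intros simp: field_simps)
  have "(f has_integral Gamma ((p + 1) / 2)) {0..}"
    unfolding f_def using p by (intro Gamma_integral_real) auto
  \<comment> \<open>Dropping the null set {0} leaves only positive x, as the \<open>powr\<close>
    computations below use.\<close>
  then have f_int: "(f has_integral Gamma ((p + 1) / 2)) {0<..}"
    by (subst has_integral_spike_set_eq[where T = "{0..}"])
       (auto intro: negligible_subset[of "{0}"])
  \<comment> \<open>The change of variables asks for absolute integrability, which holds since
    \<open>f\<close> is nonnegative.\<close>
  then have "f absolutely_integrable_on {0<..}"
    by (intro nonnegative_absolutely_integrable_1) (auto simp: f_def)
  then have "(\<lambda>x. \<bar>x / \<sigma>\<^sup>2\<bar> * f (g x)) absolutely_integrable_on {0<..} \<and>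
      integral {0<..} (\<lambda>x. \<bar>x / \<sigma>\<^sup>2\<bar> * f (g x)) = Gamma ((p + 1) / 2)"
    using f_int by (subst has_absolute_integral_change_of_variables_1'[OF _ deriv_g inj_g])
      (auto simp: image_g)
  then have "((\<lambda>x. \<bar>x / \<sigma>\<^sup>2\<bar> * f (g x)) has_integral Gamma ((p + 1) / 2)) {0<..}"
    unfolding has_integral_iff by (intro conjI set_lebesgue_integral_eq_integral(1)) (elim conjE, assumption)+
  from has_integral_mult_right[OF this, of C]
  have "((\<lambda>x. normal_density 0 \<sigma> x * \<bar>x\<bar> powr p) has_integral C * Gamma ((p + 1) / 2)) {0<..}"
  proof (rule has_integral_eq[rotated])
    fix x :: real assume x: "x \<in> {0<..}"
    have square_powr: "(y\<^sup>2) powr ((p - 1) / 2) = y powr (p - 1)" if "y > 0" for y :: real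
      using that by (simp add: powr_powr diff_divide_distrib flip: powr_numeral)
    have "(p + 1) / 2 - 1 = (p - 1) / 2"
      by (simp add: field_simps)
    then have "f (g x) = (x\<^sup>2 / (2 * \<sigma>\<^sup>2)) powr ((p - 1) / 2) * exp (- x\<^sup>2 / (2 * \<sigma>\<^sup>2))"
      unfolding f_def g_def minus_divide_left[symmetric] exp_minus divide_inverse[symmetric]
      by (simp only:)
    also have "(x\<^sup>2 / (2 * \<sigma>\<^sup>2)) powr ((p - 1) / 2) =
        x powr (p - 1) / (2 powr ((p - 1) / 2) * \<sigma> powr (p - 1))"
      using x \<sigma> square_powr by (simp add: powr_divide powr_mult)
    also have "\<dots> = (x powr p / x) / ((2 powr (p / 2) / sqrt 2) * (\<sigma> powr p / \<sigma>))"
      using x \<sigma> by (simp add: powr_diff diff_divide_distrib powr_half_sqrt)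
    finally show "C * (\<bar>x / \<sigma>\<^sup>2\<bar> * f (g x)) = normal_density 0 \<sigma> x * \<bar>x\<bar> powr p"
      using x \<sigma> by (simp add: C_def normal_density_def real_sqrt_mult power2_eq_square field_simps)
  qed
  then have "(\<integral>\<^sup>+x. ennreal (normal_density 0 \<sigma> x * \<bar>x\<bar> powr p) * indicator {0<..} x \<partial>lborel) =
      ennreal (C * Gamma ((p + 1) / 2))"
    by (intro nn_integral_has_integral_lebesgue') auto
  \<comment> \<open>The integrand vanishes at 0, so the closed half-line expected by the rule for
    even functions gives the same value.\<close>
  then have "(\<integral>\<^sup>+x. ennreal (indicator {0..} x *\<^sub>R (normal_density 0 \<sigma> x * \<bar>x\<bar> powr p)) \<partial>lborel) =
      ennreal (C * Gamma ((p + 1) / 2))"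
    using p by (subst (asm) nn_integral_cong) (auto simp: indicator_def split: if_splits)
  then have "has_bochner_integral lborel
      (\<lambda>x. indicator {0..} x *\<^sub>R (normal_density 0 \<sigma> x * \<bar>x\<bar> powr p)) (C * Gamma ((p + 1) / 2))"
    using p by (intro has_bochner_integral_nn_integral)
      (auto simp: C_def Gamma_real_pos less_imp_le)
  then have "has_bochner_integral lborel (\<lambda>x. normal_density 0 \<sigma> x * \<bar>x\<bar> powr p)
      (2 *\<^sub>R (C * Gamma ((p + 1) / 2)))"
    by (rule has_bochner_integral_even_function) (simp add: normal_density_def)
  moreover have "2 *\<^sub>R (C * Gamma ((p + 1) / 2)) =
      2 * \<sigma> powr p * Gamma p / (2 powr (p / 2) * Gamma (p / 2))"
    using powr_Gamma_half_eq[OF p] by (simp add: C_def field_simps)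
  ultimately show ?thesis
    by simp
qed

text \<open>The absolute moment of order p > 0 of a standard normal variable, already in the shape
  of the factors of the final product.\<close>

definition normal_abs_moment :: "real \<Rightarrow> real" where
  "normal_abs_moment p = 2 * Gamma p / (2 powr (p / 2) * Gamma (p / 2))"

lemma normal_abs_moment_nonneg: "p > 0 \<Longrightarrow> normal_abs_moment p \<ge> 0"
  by (simp add: normal_abs_moment_def Gamma_real_pos less_imp_le)

text \<open>One formula covers both kinds of Gaussian variable: a constant with mean 0 has v = 0,
  and \<open>0 powr (p / 2) = 0\<close>. With the nonnegative integral no integrability has to be
  carried along.\<close>

lemma (in prob_space) gaussian_rv_nn_integral_abs_powr:
  assumes "gaussian_rv M X" and mean: "expectation X = 0"
    and var: "expectation (\<lambda>\<omega>. X \<omega> * X \<omega>) = v" and p: "p > 0"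
  shows "(\<integral>\<^sup>+\<omega>. ennreal (\<bar>X \<omega>\<bar> powr p) \<partial>M) = ennreal (normal_abs_moment p * v powr (p / 2))"
proof -
  have X[measurable]: "X \<in> borel_measurable M"
    using assms(1) by (simp add: gaussian_rv_def)
  consider \<mu> where "AE \<omega> in M. X \<omega> = \<mu>"
    | \<mu> \<sigma> where "\<sigma> > 0" "distributed M lborel X (normal_density \<mu> \<sigma>)"
    using assms(1) by (auto simp: gaussian_rv_def)
  then show ?thesis
  proof cases
    case 1
    then have "expectation X = \<mu>"
      by (subst integral_cong_AE[where g = "\<lambda>_. \<mu>"]) (auto simp: prob_space)
    with 1 mean have X0: "AE \<omega> in M. X \<omega> = 0"
      by simp
    then have "v = 0"
      using var by (subst (asm) integral_cong_AE[where g = "\<lambda>_. 0"]) auto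
    moreover have "(\<integral>\<^sup>+\<omega>. ennreal (\<bar>X \<omega>\<bar> powr p) \<partial>M) = (\<integral>\<^sup>+\<omega>. 0 \<partial>M)"
      using X0 p by (intro nn_integral_cong_AE) auto
    ultimately show ?thesis
      using p by simp
  next
    case 2
    then have "\<mu> = 0"
      using mean normal_distributed_expectation by auto
    with 2 have X_normal: "distributed M lborel X (normal_density 0 \<sigma>)"
      by simp
    have "v = \<sigma>\<^sup>2"
      using normal_distributed_variance[OF \<open>\<sigma> > 0\<close> X_normal] mean var
      by (simp add: power2_eq_square)
    then have v: "v powr (p / 2) = \<sigma> powr p"
      using \<open>\<sigma> > 0\<close> by (simp add: powr_powr flip: powr_numeral)
    have "(\<integral>\<^sup>+\<omega>. ennreal (\<bar>X \<omega>\<bar> powr p) \<partial>M) =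
        (\<integral>\<^sup>+x. ennreal (normal_density 0 \<sigma> x) * ennreal (\<bar>x\<bar> powr p) \<partial>lborel)"
      by (rule distributed_nn_integral[OF X_normal, symmetric]) simp
    also have "\<dots> = (\<integral>\<^sup>+x. ennreal (normal_density 0 \<sigma> x * \<bar>x\<bar> powr p) \<partial>lborel)"
      by (simp add: ennreal_mult)
    also have "\<dots> = ennreal (2 * \<sigma> powr p * Gamma p / (2 powr (p / 2) * Gamma (p / 2)))"
      using has_bochner_integral_normal_abs_powr[OF \<open>\<sigma> > 0\<close> p]
      by (subst nn_integral_eq_integral) (auto simp: has_bochner_integral_iff)
    finally show ?thesis
      by (simp add: v normal_abs_moment_def mult_ac)
  qed
qed

section \<open>Fractional Brownian motion at a fixed time\<close>

lemma fractional_brownian_motion_gaussian_rv: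
  assumes "fractional_brownian_motion M H B" and "t \<ge> 0"
  shows "gaussian_rv M (B t)"
proof -
  have "gaussian_process M {0..} B"
    using assms by (simp add: fractional_brownian_motion_def)
  then have "gaussian_rv M (\<lambda>\<omega>. \<Sum>s\<in>{t}. 1 * B s \<omega>)"
    using assms(2) unfolding gaussian_process_def by (elim allE[of _ "{t}"] allE[of _ "\<lambda>_. 1"]) auto
  then show ?thesis
    by simp
qed

lemma fractional_brownian_motion_measurable:
  "fractional_brownian_motion M H B \<Longrightarrow> t \<ge> 0 \<Longrightarrow> B t \<in> borel_measurable M"
  using fractional_brownian_motion_gaussian_rv[of M H B t] by (simp add: gaussian_rv_def)

lemma fractional_brownian_motion_continuous:
  "fractional_brownian_motion M H B \<Longrightarrow> \<omega> \<in> space M \<Longrightarrow> continuous_on {0..} (\<lambda>t. B t \<omega>)"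
  by (simp add: fractional_brownian_motion_def)

text \<open>The covariance at s = t gives the variance \<open>t powr (2 * H)\<close>. Time 0 is
  included because the absolute value of an inner motion, which serves as time, may vanish.\<close>

lemma (in prob_space) fractional_brownian_motion_nn_integral_abs_powr:
  assumes B: "fractional_brownian_motion M H B" and t: "t \<ge> 0" and p: "p > 0"
  shows "(\<integral>\<^sup>+\<omega>. ennreal (\<bar>B t \<omega>\<bar> powr p) \<partial>M) = ennreal (normal_abs_moment p * t powr (p * H))"
proof -
  have "expectation (B t) = 0"
    using B t by (simp add: fractional_brownian_motion_def)
  moreover have "expectation (\<lambda>\<omega>. B t \<omega> * B t \<omega>) = t powr (2 * H)"
  proof -
    have "expectation (\<lambda>\<omega>. B t \<omega> * B t \<omega>) =
        (\<bar>t\<bar> powr (2 * H) + \<bar>t\<bar> powr (2 * H) - \<bar>t - t\<bar> powr (2 * H)) / 2"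
      using B t unfolding fractional_brownian_motion_def by blast
    then show ?thesis
      using t by simp
  qed
  ultimately show ?thesis
    using gaussian_rv_nn_integral_abs_powr[OF fractional_brownian_motion_gaussian_rv[OF B t] _ _ p]
    by (simp add: powr_powr mult_ac)
qed

section \<open>Joint measurability in time and sample point\<close>

text \<open>Rounding the time down to a grid of mesh 1 / (i + 1) leaves countably many times, so
  measurability at fixed times suffices for the approximants; path continuity gives their pointwise
  limit.\<close>

lemma borel_measurable_pair_continuous:
  fixes f :: "real \<Rightarrow> 'a \<Rightarrow> real"
  assumes meas: "\<And>s. f s \<in> borel_measurable N"
    and cont: "\<And>\<omega>. \<omega> \<in> space N \<Longrightarrow> continuous_on UNIV (\<lambda>s. f s \<omega>)"
  shows "(\<lambda>(s, \<omega>). f s \<omega>) \<in> borel_measurable (borel \<Otimes>\<^sub>M N)"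
proof -
  define r where "r i s = of_int \<lfloor>s * real (Suc i)\<rfloor> / real (Suc i)" for i and s :: real
  have r_lim: "(\<lambda>i. r i s) \<longlonglongrightarrow> s" for s
  proof (rule tendsto_sandwich)
    show "\<forall>\<^sub>F i in sequentially. s - 1 / real (Suc i) \<le> r i s"
    proof (intro always_eventually allI)
      fix i
      have "(s - 1 / real (Suc i)) * real (Suc i) = s * real (Suc i) - 1"
        by (simp add: field_simps)
      also have "\<dots> \<le> of_int \<lfloor>s * real (Suc i)\<rfloor>"
        by linarith
      finally show "s - 1 / real (Suc i) \<le> r i s"
        by (simp add: r_def le_divide_eq del: of_nat_Suc)
    qed
    show "\<forall>\<^sub>F i in sequentially. r i s \<le> s"
      unfolding r_def by (intro always_eventually allI) (simp add: divide_le_eq del: of_nat_Suc)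
    show "(\<lambda>i. s - 1 / real (Suc i)) \<longlonglongrightarrow> s"
      using tendsto_diff[OF tendsto_const[of s] LIMSEQ_inverse_real_of_nat] by (simp add: inverse_eq_divide)
  qed simp
  show ?thesis
  proof (rule borel_measurable_LIMSEQ_real)
    fix x :: "real \<times> 'a" assume "x \<in> space (borel \<Otimes>\<^sub>M N)"
    then have "isCont (\<lambda>s. f s (snd x)) (fst x)"
      using cont[of "snd x"] by (auto simp: space_pair_measure continuous_on_eq_continuous_at)
    then show "(\<lambda>i. f (r i (fst x)) (snd x)) \<longlonglongrightarrow> (case x of (s, \<omega>) \<Rightarrow> f s \<omega>)"
      using isCont_tendsto_compose[OF _ r_lim, of "fst x" "\<lambda>s. f s (snd x)"]
      by (simp add: case_prod_beta)
  next
    fix i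
    show "(\<lambda>x. f (r i (fst x)) (snd x)) \<in> borel_measurable (borel \<Otimes>\<^sub>M N)"
      unfolding r_def
      \<comment> \<open>Once the integer value of the floor is fixed, the time is deterministic and
        \<open>meas\<close> applies.\<close>
      by (rule measurable_compose_countable[where
            f = "\<lambda>j x. f (of_int j / real (Suc i)) (snd x)" and
            g = "\<lambda>x. \<lfloor>fst x * real (Suc i)\<rfloor>"])
         (auto intro!: measurable_compose[OF measurable_snd meas])
  qed
qed

lemma borel_measurable_pair_abs:
  fixes f :: "real \<Rightarrow> 'a \<Rightarrow> real"
  assumes "\<And>s. s \<ge> 0 \<Longrightarrow> f s \<in> borel_measurable N"
    and cont: "\<And>\<omega>. \<omega> \<in> space N \<Longrightarrow> continuous_on {0..} (\<lambda>s. f s \<omega>)"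
  shows "(\<lambda>(s, \<omega>). f \<bar>s\<bar> \<omega>) \<in> borel_measurable (borel \<Otimes>\<^sub>M N)"
proof (rule borel_measurable_pair_continuous)
  fix \<omega> assume "\<omega> \<in> space N"
  moreover have "range (abs :: real \<Rightarrow> real) \<subseteq> {0..}"
    by auto
  ultimately show "continuous_on UNIV (\<lambda>s. f \<bar>s\<bar> \<omega>)"
    by (intro continuous_on_compose2[OF cont continuous_on_rabs[OF continuous_on_id]])
qed (use assms in auto)

text \<open>Measurability at each fixed time would not survive the induction, since the next motion
  is inserted as a random time. \<open>N\<close> is left general so as to serve both for
  \<open>M\<close> and for the \<sigma>-algebra generated by the outer motions.\<close>

lemma iterated_process_measurable:
  fixes B :: "nat \<Rightarrow> real \<Rightarrow> 'a \<Rightarrow> real"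
  assumes meas: "\<And>j s. j \<in> {1..n + 1} \<Longrightarrow> s \<ge> 0 \<Longrightarrow> B j s \<in> borel_measurable N"
    and cont: "\<And>j \<omega>. j \<in> {1..n + 1} \<Longrightarrow> \<omega> \<in> space N \<Longrightarrow> continuous_on {0..} (\<lambda>s. B j s \<omega>)"
  shows "(\<lambda>(s, \<omega>). iterated_process B n \<bar>s\<bar> \<omega>) \<in> borel_measurable (borel \<Otimes>\<^sub>M N)"
  using assms
proof (induction n)
  case 0
  then show ?case
    using borel_measurable_pair_abs[of "B 1" N] by simp
next
  case (Suc n)
  have B: "(\<lambda>(s, \<omega>). B (n + 2) \<bar>s\<bar> \<omega>) \<in> borel_measurable (borel \<Otimes>\<^sub>M N)"
    by (rule borel_measurable_pair_abs) (use Suc.prems in auto)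
  have I: "(\<lambda>(s, \<omega>). iterated_process B n \<bar>s\<bar> \<omega>) \<in> borel_measurable (borel \<Otimes>\<^sub>M N)"
    by (rule Suc.IH) (use Suc.prems in auto)
  show ?case
    using measurable_compose[OF measurable_Pair[OF B measurable_snd] I]
    by (simp add: case_prod_beta)
qed

section \<open>Independence and integration with one argument frozen\<close>

text \<open>Phrasing independence in terms of \<open>\<sigma>\<close>-algebras on \<open>space M\<close> itself keeps the sample
  points, and with them the continuity of the sample paths, available.\<close>

lemma (in prob_space) indep_var_vimage_algebra:
  assumes "indep_var K F L G"
  shows "indep_var (vimage_algebra (space M) F K) (\<lambda>\<omega>. \<omega>) (vimage_algebra (space M) G L) (\<lambda>\<omega>. \<omega>)"
proof -
  have F: "F \<in> measurable M K" and G: "G \<in> measurable M L"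
    using assms by (auto dest: indep_var_rv1 indep_var_rv2)
  \<comment> \<open>Independence depends only on the families of preimages, and the identity into
    the pulled-back \<sigma>-algebra has the same preimages as the original map.\<close>
  have eq: "{(\<lambda>\<omega>. \<omega>) -` A \<inter> space M |A. A \<in> sets (vimage_algebra (space M) F' K')} =
      {F' -` A \<inter> space M |A. A \<in> sets K'}" if "F' \<in> measurable M K'" for F' :: "'a \<Rightarrow> 'b" and K'
  proof -
    have "F' \<in> space M \<rightarrow> space K'"
      using that by (simp add: measurable_def)
    from sets_vimage_algebra2[OF this] show ?thesis
      by (auto 4 3)
  qed
  have id: "(\<lambda>\<omega>. \<omega>) \<in> measurable M (vimage_algebra (space M) F' K')"
    if "F' \<in> measurable M K'" for F' :: "'a \<Rightarrow> 'b" and K'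
    using that by (intro measurable_vimage_algebra2) auto
  show ?thesis
    using assms unfolding indep_var_eq eq[OF F] eq[OF G] by (simp add: id F G)
qed

text \<open>This replaces conditioning on \<open>X\<close>: independence makes the law of the pair
  (\<omega>, \<omega>) on \<open>N \<Otimes>\<^sub>M L\<close> a product, so Fubini integrates out
  the first copy while \<open>X\<close> is frozen in the second.\<close>

lemma (in prob_space) indep_var_nn_integral_compose:
  assumes ind: "indep_var N (\<lambda>\<omega>. \<omega>) L (\<lambda>\<omega>. \<omega>)" and X: "X \<in> borel_measurable L"
    and f: "(\<lambda>(s, \<omega>). f s \<omega>) \<in> borel_measurable (borel \<Otimes>\<^sub>M N)"
    and g: "\<And>s. (\<integral>\<^sup>+\<omega>. f s \<omega> \<partial>M) = g s"
  shows "(\<integral>\<^sup>+\<omega>. f (X \<omega>) \<omega> \<partial>M) = (\<integral>\<^sup>+\<omega>. g (X \<omega>) \<partial>M)"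
proof -
  let ?N = "distr M N (\<lambda>\<omega>. \<omega>)" and ?L = "distr M L (\<lambda>\<omega>. \<omega>)"
  have idN: "(\<lambda>\<omega>. \<omega>) \<in> measurable M N" and idL: "(\<lambda>\<omega>. \<omega>) \<in> measurable M L"
    using ind by (auto dest: indep_var_rv1 indep_var_rv2)
  interpret N: prob_space ?N
    by (rule prob_space_distr[OF idN])
  interpret L: prob_space ?L
    by (rule prob_space_distr[OF idL])
  interpret NL: pair_prob_space ?N ?L ..
  have fX: "(\<lambda>z. f (X (snd z)) (fst z)) \<in> borel_measurable (N \<Otimes>\<^sub>M L)"
    using measurable_compose[OF measurable_Pair[OF measurable_compose[OF measurable_snd X] measurable_fst] f]
    by simp
  have "(\<lambda>\<omega>. f s \<omega>) \<in> borel_measurable N" for s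
    using measurable_compose[OF measurable_Pair1' f, of s] by simp
  then have g': "(\<integral>\<^sup>+\<omega>. f s \<omega> \<partial>?N) = g s" for s
    using g[of s] by (simp add: nn_integral_distr[OF idN])
  have g_meas: "g \<in> borel_measurable borel"
    using N.borel_measurable_nn_integral[of "\<lambda>s \<omega>. f s \<omega>" borel] f by (simp add: g')
  \<comment> \<open>Transport along the diagonal separates the two roles of \<omega>: the first copy
    drives \<open>f\<close>, the second drives \<open>X\<close>.\<close>
  have "(\<integral>\<^sup>+\<omega>. f (X \<omega>) \<omega> \<partial>M) =
      (\<integral>\<^sup>+z. f (X (snd z)) (fst z) \<partial>distr M (N \<Otimes>\<^sub>M L) (\<lambda>\<omega>. (\<omega>, \<omega>)))"
    by (subst nn_integral_distr[OF measurable_Pair[OF idN idL]]) (use fX in simp_all)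
  also have "\<dots> = (\<integral>\<^sup>+z. f (X (snd z)) (fst z) \<partial>(?N \<Otimes>\<^sub>M ?L))"
    using ind unfolding indep_var_distribution_eq by simp
  also have "\<dots> = (\<integral>\<^sup>+\<omega>'. (\<integral>\<^sup>+\<omega>. f (X \<omega>') \<omega> \<partial>?N) \<partial>?L)"
    using fX by (subst NL.nn_integral_snd[symmetric]) auto
  also have "\<dots> = (\<integral>\<^sup>+\<omega>. g (X \<omega>) \<partial>?L)"
    by (simp add: g')
  also have "\<dots> = (\<integral>\<^sup>+\<omega>. g (X \<omega>) \<partial>M)"
    using measurable_compose[OF X g_meas] by (intro nn_integral_distr[OF idL]) simp
  finally show ?thesis .
qed

section \<open>Moments of the iterated process\<close>

text \<open>The form with \<open>\<bar>s\<bar>\<close> for every real s lets the induction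
  hypothesis be applied at the value of the innermost motion, whatever its sign.\<close>

lemma (in prob_space) iterated_process_nn_integral_abs_powr:
  fixes B :: "nat \<Rightarrow> real \<Rightarrow> 'a \<Rightarrow> real"
  assumes "\<And>j. j \<in> {1..n + 1} \<Longrightarrow> H j > 0" and H0: "H 0 = 1"
    and "\<And>j. j \<in> {1..n + 1} \<Longrightarrow> fractional_brownian_motion M (H j) (B j)"
    and "indep_processes M {1..n + 1} B"
    and p: "p > 0"
  shows "(\<integral>\<^sup>+\<omega>. ennreal (\<bar>iterated_process B n \<bar>s\<bar> \<omega>\<bar> powr p) \<partial>M) =
    ennreal ((\<Prod>r=0..n. normal_abs_moment (p * (\<Prod>j=0..r. H j))) * \<bar>s\<bar> powr (p * (\<Prod>j=0..n + 1. H j)))"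
  using assms(1,3,4)
proof (induction n arbitrary: s)
  case 0
  then show ?case
    using fractional_brownian_motion_nn_integral_abs_powr[of "H 1" "B 1" "\<bar>s\<bar>" p] p H0
    by simp
next
  case (Suc n)
  let ?R = "\<lambda>j \<omega>. \<lambda>u\<in>{0..}. B j u \<omega>" and ?P = "\<lambda>_::nat. PiM {0..} (\<lambda>_::real. borel :: real measure)"
  let ?C = "\<Prod>r=0..n. normal_abs_moment (p * (\<Prod>j=0..r. H j))"
  let ?q = "p * (\<Prod>j=0..n + 1. H j)"
  have Hpos: "H j > 0" if "j \<le> n + 2" for j
    using Suc.prems(1)[of j] H0 that by (cases "j = 0") auto
  have q: "?q > 0"
    using p Hpos by (intro mult_pos_pos prod_pos) auto
  have C: "?C \<ge> 0"
    using p Hpos by (intro prod_nonneg normal_abs_moment_nonneg ballI mult_pos_pos prod_pos) auto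
  have ind: "indep_vars ?P ?R {1..Suc n + 1}"
    using Suc.prems(3) by (simp add: indep_processes_def)
  have fbm: "fractional_brownian_motion M (H j) (B j)" if "j \<in> {1..n + 2}" for j
    using Suc.prems(2)[of j] that by simp
  \<comment> \<open>\<open>F J\<close> bundles the paths of the motions in \<open>J\<close>, and
    \<open>N J\<close> is the \<sigma>-algebra they generate on \<open>space M\<close>. The outer
    motions 1 to n + 1 are then separated from the innermost one, number n + 2.\<close>
  define F where "F J \<omega> = (\<lambda>j\<in>J. ?R j \<omega>)" for J \<omega>
  define N where "N J = vimage_algebra (space M) (F J) (PiM J ?P)" for J
  define X where "X = B (n + 2) \<bar>s\<bar>"
  have "indep_var (PiM {1..n + 1} ?P) (F {1..n + 1}) (PiM {n + 2} ?P) (F {n + 2})"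
    unfolding F_def by (rule indep_var_restrict[OF ind]) auto
  then have indN: "indep_var (N {1..n + 1}) (\<lambda>\<omega>. \<omega>) (N {n + 2}) (\<lambda>\<omega>. \<omega>)"
    unfolding N_def by (rule indep_var_vimage_algebra)
  have B_meas: "B j u \<in> borel_measurable (N J)" if "j \<in> J" "u \<ge> 0" for j u J
  proof -
    have "F J \<in> measurable (N J) (PiM J ?P)"
      unfolding N_def by (rule measurable_vimage_algebra1) (auto simp: F_def space_PiM PiE_def)
    moreover have "(\<lambda>x. x j u) \<in> borel_measurable (PiM J ?P)"
      using that
      by (intro measurable_compose[OF measurable_component_singleton[of j J ?P]
            measurable_component_singleton[of u "{0..}" "\<lambda>_. borel"]]) auto
    ultimately have "(\<lambda>\<omega>. F J \<omega> j u) \<in> borel_measurable (N J)"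
      by (rule measurable_compose)
    then show ?thesis
      using that by (simp add: F_def)
  qed
  have X_meas: "X \<in> borel_measurable (N {n + 2})"
    unfolding X_def by (rule B_meas) auto
  have X_meas': "X \<in> borel_measurable M"
    using measurable_compose[OF indep_var_rv2[OF indN] X_meas] by simp
  have I_meas: "(\<lambda>(u, \<omega>). iterated_process B n \<bar>u\<bar> \<omega>) \<in> borel_measurable (borel \<Otimes>\<^sub>M N {1..n + 1})"
    by (rule iterated_process_measurable)
       (use B_meas fractional_brownian_motion_continuous[OF fbm] in \<open>auto simp: N_def\<close>)
  have IH: "(\<integral>\<^sup>+\<omega>. ennreal (\<bar>iterated_process B n \<bar>u\<bar> \<omega>\<bar> powr p) \<partial>M) =
      ennreal (?C * \<bar>u\<bar> powr ?q)" for u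
  proof (rule Suc.IH)
    show "indep_processes M {1..n + 1} B"
      unfolding indep_processes_def by (rule indep_vars_subset[OF ind]) auto
  qed (use Suc.prems in auto)
  have "(\<integral>\<^sup>+\<omega>. ennreal (\<bar>iterated_process B (Suc n) \<bar>s\<bar> \<omega>\<bar> powr p) \<partial>M) =
      (\<integral>\<^sup>+\<omega>. ennreal (\<bar>iterated_process B n \<bar>X \<omega>\<bar> \<omega>\<bar> powr p) \<partial>M)"
    by (simp add: X_def)
  \<comment> \<open>With the time frozen at u, the induction hypothesis evaluates the outer
    integral, and u is then replaced by the random \<open>X\<close>.\<close>
  also have "\<dots> = (\<integral>\<^sup>+\<omega>. ennreal (?C * \<bar>X \<omega>\<bar> powr ?q) \<partial>M)"
    by (rule indep_var_nn_integral_compose[OF indN X_meas _ IH])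
       (use measurable_compose[OF I_meas, of "\<lambda>x. ennreal (\<bar>x\<bar> powr p)" borel]
         in \<open>simp add: case_prod_beta\<close>)
  also have "\<dots> = ennreal ?C * (\<integral>\<^sup>+\<omega>. ennreal (\<bar>X \<omega>\<bar> powr ?q) \<partial>M)"
    using C X_meas' by (simp add: ennreal_mult nn_integral_cmult)
  \<comment> \<open>The moment of order \<open>?q\<close> of the innermost motion supplies the
    factor r = n + 1 of the product and the last Hurst parameter in the exponent.\<close>
  also have "(\<integral>\<^sup>+\<omega>. ennreal (\<bar>X \<omega>\<bar> powr ?q) \<partial>M) =
      ennreal (normal_abs_moment ?q * \<bar>s\<bar> powr (?q * H (n + 2)))"
    unfolding X_def
    by (rule fractional_brownian_motion_nn_integral_abs_powr) (use q fbm in auto)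
  also have "ennreal ?C * \<dots> = ennreal (?C * normal_abs_moment ?q * \<bar>s\<bar> powr (?q * H (n + 2)))"
    using C normal_abs_moment_nonneg[OF q] by (simp add: mult.assoc flip: ennreal_mult)
  finally show ?case
    by (simp add: mult_ac)
qed

theorem theorem2p6:
  fixes M :: "'a measure" and n k :: nat and H :: "nat \<Rightarrow> real"
    and B :: "nat \<Rightarrow> real \<Rightarrow> 'a \<Rightarrow> real" and t :: real
  assumes "prob_space M"
    and "n \<ge> 1"
    and "H 0 = 1"
    and "\<And>j. j \<in> {1..n + 1} \<Longrightarrow> H j \<in> {0<..<1}"
    and "\<And>j. j \<in> {1..n + 1} \<Longrightarrow> fractional_brownian_motion M (H j) (B j)"
    and "indep_processes M {1..n + 1} B"
    and "t > 0"
    and "k \<ge> 1"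
  shows "(\<integral>\<omega>. (iterated_process B n t \<omega>) ^ (2 * k) \<partial>M) =
    2 ^ (n + 1) * t powr (2 * real k * (\<Prod>j=1..n + 1. H j))
      / 2 powr (real k * (\<Sum>r=0..n. \<Prod>j=0..r. H j))
      * (\<Prod>r=0..n. Gamma (2 * real k * (\<Prod>j=0..r. H j)) / Gamma (real k * (\<Prod>j=0..r. H j)))"
proof -
  interpret prob_space M by fact
  have Hpos: "H j > 0" if "j \<le> n + 1" for j
    using assms(4)[of j] assms(3) that by (cases "j = 0") auto
  let ?h = "\<lambda>r. \<Prod>j=0..r. H j"
  let ?C = "\<Prod>r=0..n. normal_abs_moment (2 * real k * ?h r)"
  have C: "?C \<ge> 0"
    using \<open>k \<ge> 1\<close> Hpos
    by (intro prod_nonneg normal_abs_moment_nonneg ballI mult_pos_pos prod_pos) auto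
  have "(\<lambda>(s, \<omega>). iterated_process B n \<bar>s\<bar> \<omega>) \<in> borel_measurable (borel \<Otimes>\<^sub>M M)"
    by (rule iterated_process_measurable)
       (use fractional_brownian_motion_measurable[OF assms(5)]
          fractional_brownian_motion_continuous[OF assms(5)] in auto)
  from measurable_compose[OF measurable_Pair1' this, of t]
  have I[measurable]: "iterated_process B n t \<in> borel_measurable M"
    using \<open>t > 0\<close> by simp
  \<comment> \<open>The condition on k matters at x = 0, since \<open>0 powr 0\<close> is 0 whereas
    \<open>0 ^ 0\<close> is 1.\<close>
  have abs: "\<bar>x\<bar> powr (2 * real k) = x ^ (2 * k)" for x :: real
    using powr_realpow'[of "\<bar>x\<bar>" "2 * k"] \<open>k \<ge> 1\<close> by (simp add: power_even_abs)
  have "(\<integral>\<^sup>+\<omega>. ennreal (\<bar>iterated_process B n \<bar>t\<bar> \<omega>\<bar> powr (2 * real k)) \<partial>M) =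
      ennreal (?C * \<bar>t\<bar> powr (2 * real k * ?h (n + 1)))"
  proof (rule iterated_process_nn_integral_abs_powr)
    show "fractional_brownian_motion M (H j) (B j)" if "j \<in> {1..n + 1}" for j
      using that by (rule assms(5))
  qed (use Hpos assms(3,6,8) in auto)
  then have "(\<integral>\<^sup>+\<omega>. ennreal (iterated_process B n t \<omega> ^ (2 * k)) \<partial>M) =
      ennreal (?C * t powr (2 * real k * ?h (n + 1)))"
    using \<open>t > 0\<close> by (simp only: abs abs_of_pos)
  \<comment> \<open>An even power is nonnegative, so its Lebesgue integral can be read off from the
    nonnegative integral.\<close>
  then have "(\<integral>\<omega>. (iterated_process B n t \<omega>) ^ (2 * k) \<partial>M) =
      ?C * t powr (2 * real k * ?h (n + 1))"
    by (intro trans[OF integral_eq_nn_integral])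
       (simp_all only: enn2real_ennreal mult_nonneg_nonneg[OF C powr_ge_zero], simp_all)
  also have "?h (n + 1) = (\<Prod>j=1..n + 1. H j)"
    using assms(3) by (subst prod.atLeast_Suc_atMost) auto
  also have "?C = 2 ^ (n + 1) / 2 powr (real k * (\<Sum>r=0..n. ?h r))
      * (\<Prod>r=0..n. Gamma (2 * real k * ?h r) / Gamma (real k * ?h r))"
  proof -
    have "normal_abs_moment (2 * real k * x) =
        2 / 2 powr (real k * x) * (Gamma (2 * real k * x) / Gamma (real k * x))" for x
      by (simp add: normal_abs_moment_def)
    then have "?C = (\<Prod>r=0..n. 2 / 2 powr (real k * ?h r)) *
        (\<Prod>r=0..n. Gamma (2 * real k * ?h r) / Gamma (real k * ?h r))"
      by (simp only: prod.distrib)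
    also have "(\<Prod>r=0..n. 2 / 2 powr (real k * ?h r)) = 2 ^ (n + 1) / 2 powr (real k * (\<Sum>r=0..n. ?h r))"
      by (simp add: prod_dividef powr_sum sum_distrib_left)
    finally show ?thesis .
  qed
  finally show ?thesis
    by simp
qed

end
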